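(* If $n$ is a positive integer and $t$ is any integer, then $$\sum_{k=0}^n(-1)^{n-k}\frac{n}{n+k}\binom{n+k}{n-k}L_{3k+t}=\begin{cases}\frac52F_tF_n,& n\text{ odd};\\ \frac12L_tL_n,& n\text{ even};\end{cases}$$ $$\sum_{k=0}^n(-1)^{n-k}\frac{n}{n+k}\binom{n+k}{n-k}F_{3k+t}=\begin{cases}\frac12L_tF_n,& n\text{ odd};\\ \frac12F_tL_n,& n\text{ even}.\end{cases}$$
   Context: $F_n$ and $L_n$ ($n\in\mathbb{Z}$) are the Fibonacci and Lucas numbers: $F_0=0$, $F_1=1$, $F_n=F_{n-1}+F_{n-2}$; $L_0=2$, $L_1=1$, $L_n=L_{n-1}+L_{n-2}$, extended to negative indices by $F_{-n}=(-1)^{n-1}F_n$, $L_{-n}=(-1)^nL_n$. *)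

theory Defs
  imports Complex_Main "HOL-Number_Theory.Fib"
begin

fun lucas :: "nat \<Rightarrow> nat" where
  "lucas 0 = 2"
| "lucas (Suc 0) = 1"
| "lucas (Suc (Suc n)) = lucas (Suc n) + lucas n"

(* Extension to negative indices: F_{-m} = (-1)^(m-1) F_m and L_{-m} = (-1)^m L_m.
   In the negative branch nat (- i) >= 1, so the natural subtraction does not truncate. *)

definition fib_int :: "int \<Rightarrow> int" where
  "fib_int i = (if 0 \<le> i then int (fib (nat i))
     else (- 1) ^ (nat (- i) - 1) * int (fib (nat (- i))))"

definition lucas_int :: "int \<Rightarrow> int" where
  "lucas_int i = (if 0 \<le> i then int (lucas (nat i))
     else (- 1) ^ nat (- i) * int (lucas (nat (- i))))"

lemma fib_int_rec: "fib_int i = fib_int (i - 1) + fib_int (i - 2)"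
proof -
  consider (pos) m where "i = int (Suc (Suc m))" | (one) "i = 1" | (zero) "i = 0"
    | (neg) m where "i = - int (Suc m)"
  proof (cases i)
    case (nonneg k)
    then show ?thesis using that by (cases k rule: fib.cases) auto
  qed (use that in blast)
  then show ?thesis
  proof cases
    case pos
    then have "nat i = Suc (Suc m)" "nat (i - 1) = Suc m" "nat (i - 2) = m" by auto
    then show ?thesis using pos by (simp add: fib_int_def)
  next
    case neg
    then have "nat (- i) = Suc m" "nat (- (i - 1)) = Suc (Suc m)"
      "nat (- (i - 2)) = Suc (Suc (Suc m))" by auto
    moreover have "\<not> 0 \<le> i" "\<not> 0 \<le> i - 1" "\<not> 0 \<le> i - 2" using neg by auto
    ultimately show ?thesis unfolding fib_int_def by (simp only: if_False) (simp add: algebra_simps)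
  qed (simp_all add: fib_int_def numeral_2_eq_2)
qed

lemma lucas_int_rec: "lucas_int i = lucas_int (i - 1) + lucas_int (i - 2)"
proof -
  consider (pos) m where "i = int (Suc (Suc m))" | (one) "i = 1" | (zero) "i = 0"
    | (neg) m where "i = - int (Suc m)"
  proof (cases i)
    case (nonneg k)
    then show ?thesis using that by (cases k rule: lucas.cases) auto
  qed (use that in blast)
  then show ?thesis
  proof cases
    case pos
    then have "nat i = Suc (Suc m)" "nat (i - 1) = Suc m" "nat (i - 2) = m" by auto
    then show ?thesis using pos by (simp add: lucas_int_def)
  next
    case neg
    then have "nat (- i) = Suc m" "nat (- (i - 1)) = Suc (Suc m)"
      "nat (- (i - 2)) = Suc (Suc (Suc m))" by auto
    moreover have "\<not> 0 \<le> i" "\<not> 0 \<le> i - 1" "\<not> 0 \<le> i - 2" using neg by auto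
    ultimately show ?thesis unfolding lucas_int_def by (simp only: if_False) (simp add: algebra_simps)
  qed (simp_all add: lucas_int_def numeral_2_eq_2)
qed

end

theory Submission
  imports Defs
begin

text \<open>
  The polynomials $P_n(x) = \sum_k (-1)^{n-k} \frac{n}{n+k} \binom{n+k}{n-k} x^k$, with $P_0 = 1$, are
  the rescaled Chebyshev polynomials $T_n(x/2 - 1)$, so $P_{n+2} = (x - 2) P_{n+1} - P_n$. Reading $x$
  as the shift $t \mapsto t + 3$, the operator $x - 2$ sends $G_t$ to $G_{t+3} - 2 G_t = G_{t+1} + G_{t-1}$
  for any $G$ satisfying the Fibonacci recurrence. This is $L_t$ for $G = F$ and $5 F_t$ for $G = L$,
  and the theorem follows by induction on $n$.
\<close>

text \<open>Twice the unsigned coefficient of $P_n$. In the case $n = k = 0$ the truncated subtraction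
  yields the value 2, which is the one that the recurrence needs.\<close>

definition cheb_coeff :: "nat \<Rightarrow> nat \<Rightarrow> real" where
  "cheb_coeff n k = real ((n + k) choose (2 * k)) + real ((n + k - 1) choose (2 * k))"

lemma cheb_coeff_0_right [simp]: "cheb_coeff n 0 = 2"
  by (simp add: cheb_coeff_def)

lemma cheb_coeff_eq_0: "n < k \<Longrightarrow> cheb_coeff n k = 0"
  by (simp add: cheb_coeff_def binomial_eq_0)

text \<open>By absorption the second binomial in \<open>cheb_coeff\<close> is
  \<open>(n - k) / (n + k)\<close> times the first, and
  \<open>1 + (n - k) / (n + k) = 2 n / (n + k)\<close>.\<close>

lemma cheb_coeff_closed_form:
  assumes "n > 0" "k \<le> n"
  shows "real n / real (n + k) * real ((n + k) choose (n - k)) = cheb_coeff n k / 2"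
proof -
  obtain m where m: "n + k = Suc m" using assms by (cases "n + k") auto
  have "(n + k) choose (n - k) = (n + k) choose (2 * k)"
    using assms binomial_symmetric[of "n - k" "n + k"] by (simp add: mult_2)
  moreover have "(n + k) * ((n + k - 1) choose (2 * k)) = (n - k) * ((n + k) choose (2 * k))"
    using binomial_absorb_comp[of "n + k" "2 * k"] by (simp add: mult_2)
  then have "real (n + k) * real ((n + k - 1) choose (2 * k))
      = (real n - real k) * real ((n + k) choose (2 * k))"
    using assms by (metis of_nat_diff of_nat_mult)
  ultimately show ?thesis
    using assms by (simp add: cheb_coeff_def field_simps)
qed

lemma binomial_second_difference:
  "real (Suc (Suc m) choose Suc (Suc j)) + real (m choose Suc (Suc j))
   = 2 * real (Suc m choose Suc (Suc j)) + real (m choose j)"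
  by simp

text \<open>Second differences in the upper index lower the bottom index by two; apply this to both
  binomials of \<open>cheb_coeff\<close>. Up to sign it compares the coefficients of
  \<open>x^(k+1)\<close> in the recurrence for \<open>P_n\<close>.\<close>

lemma cheb_coeff_rec:
  "cheb_coeff (Suc (Suc n)) (Suc k)
   = cheb_coeff (Suc n) k + 2 * cheb_coeff (Suc n) (Suc k) - cheb_coeff n (Suc k)"
  using binomial_second_difference[of "n + k" "2 * k"]
    binomial_second_difference[of "Suc (n + k)" "2 * k"]
  by (simp add: cheb_coeff_def del: binomial_Suc_Suc)

text \<open>This is \<open>2 P_n\<close> with \<open>x^k\<close> replaced by \<open>g k\<close>, so
  multiplication by \<open>x\<close> becomes a shift of \<open>g\<close>. The exponent
  \<open>n + k\<close> has the parity of \<open>n - k\<close> and stays meaningful for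
  \<open>k > n\<close>.\<close>

definition cheb_sum :: "nat \<Rightarrow> (nat \<Rightarrow> real) \<Rightarrow> real" where
  "cheb_sum n g = (\<Sum>k\<le>n. (- 1) ^ (n + k) * cheb_coeff n k * g k)"

lemma cheb_sum_extend:
  assumes "n \<le> N"
  shows "cheb_sum n g = (\<Sum>k\<le>N. (- 1) ^ (n + k) * cheb_coeff n k * g k)"
  unfolding cheb_sum_def
  using assms by (intro sum.mono_neutral_left) (auto simp: cheb_coeff_eq_0)

lemma cheb_sum_rec:
  "cheb_sum (Suc (Suc n)) g
   = cheb_sum (Suc n) (\<lambda>k. g (Suc k)) - 2 * cheb_sum (Suc n) g - cheb_sum n g"
proof -
  \<comment> \<open>Splitting off \<open>k = 0\<close> leaves terms to which
    \<open>cheb_coeff_rec\<close> applies; a common range for all \<open>m\<close> lets the sums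
    combine termwise.\<close>
  have shift: "cheb_sum m g = (- 1) ^ m * 2 * g 0
      - (\<Sum>k\<le>Suc n. (- 1) ^ (m + k) * cheb_coeff m (Suc k) * g (Suc k))"
    if "m \<le> Suc (Suc n)" for m
    unfolding cheb_sum_extend[OF that] sum.atMost_Suc_shift[of _ "Suc n"]
    by (simp add: sum_negf del: sum.atMost_Suc)
  show ?thesis
    unfolding shift[OF order.refl] shift[OF le_SucI[OF order.refl]] shift[OF le_SucI[OF le_SucI[OF order.refl]]]
    unfolding cheb_sum_def
    by (simp add: cheb_coeff_rec algebra_simps sum.distrib sum_subtractf sum_negf sum_distrib_left
        del: sum.atMost_Suc)
qed

lemma lucas_int_eq_fib_int: "lucas_int i = fib_int (i + 1) + fib_int (i - 1)"
proof -
  let ?P = "\<lambda>i. lucas_int i = fib_int (i + 1) + fib_int (i - 1)"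
  \<comment> \<open>Two consecutive instances are carried along, since the recurrences have order
    two; the induction runs in both directions from 0.\<close>
  have "?P i \<and> ?P (i + 1)"
  proof (induction i rule: int_induct[of _ 0])
    case base
    show ?case by (simp add: lucas_int_def fib_int_def numeral_2_eq_2)
  next
    case (step1 i)
    then show ?case
      using lucas_int_rec[of "i + 2"] fib_int_rec[of "i + 3"] fib_int_rec[of "i + 1"]
      by (simp add: algebra_simps)
  next
    case (step2 i)
    then show ?case
      using lucas_int_rec[of "i + 1"] fib_int_rec[of "i + 2"] fib_int_rec[of i]
      by (simp add: algebra_simps)
  qed
  then show ?thesis ..
qed

lemma five_fib_int_eq_lucas_int: "5 * fib_int i = lucas_int (i + 1) + lucas_int (i - 1)"
  using lucas_int_eq_fib_int[of "i + 1"] lucas_int_eq_fib_int[of "i - 1"]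
    fib_int_rec[of "i + 2"] fib_int_rec[of "i + 1"] fib_int_rec[of i]
  by (simp add: add.commute)

lemma lucas_int_add_3: "lucas_int (i + 3) - 2 * lucas_int i = 5 * fib_int i"
  using lucas_int_rec[of "i + 3"] lucas_int_rec[of "i + 2"] lucas_int_rec[of "i + 1"]
    five_fib_int_eq_lucas_int[of i]
  by (simp add: add.commute)

lemma fib_int_add_3: "fib_int (i + 3) - 2 * fib_int i = lucas_int i"
  using fib_int_rec[of "i + 3"] fib_int_rec[of "i + 2"] fib_int_rec[of "i + 1"]
    lucas_int_eq_fib_int[of i]
  by (simp add: add.commute)

lemma cheb_sum_0 [simp]: "cheb_sum 0 g = 2 * g 0"
  by (simp add: cheb_sum_def)

lemma cheb_sum_1 [simp]: "cheb_sum (Suc 0) g = g 1 - 2 * g 0"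
  by (simp add: cheb_sum_def cheb_coeff_def numeral_2_eq_2)

text \<open>Both sums are treated together because \<open>x - 2\<close> exchanges the two sequences,
  up to the factor 5.\<close>

lemma cheb_sum_lucas_fib:
  "cheb_sum n (\<lambda>k. real_of_int (lucas_int (3 * int k + t)))
     = real_of_int (if odd n then 5 * fib_int t * fib_int (int n) else lucas_int t * lucas_int (int n))
   \<and> cheb_sum n (\<lambda>k. real_of_int (fib_int (3 * int k + t)))
     = real_of_int (if odd n then lucas_int t * fib_int (int n) else fib_int t * lucas_int (int n))"
proof (induction n arbitrary: t rule: induct_nat_012)
  case 0
  show ?case by (simp add: lucas_int_def)
next
  case 1
  have "fib_int 1 = 1" by (simp add: fib_int_def)
  moreover have "real_of_int (lucas_int (3 + t)) - 2 * real_of_int (lucas_int t) = 5 * real_of_int (fib_int t)"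
    "real_of_int (fib_int (3 + t)) - 2 * real_of_int (fib_int t) = real_of_int (lucas_int t)"
    using lucas_int_add_3[of t] fib_int_add_3[of t] by (simp_all add: add.commute)
  ultimately show ?case by simp
next
  case (ge2 n)
  have shift: "3 * int (Suc k) + t = 3 * int k + (t + 3)" for k by simp
  have idx: "int (Suc (Suc n)) = int n + 2" "int (Suc n) = int n + 1" by auto
  have L3: "lucas_int (t + 3) = 2 * lucas_int t + 5 * fib_int t"
    using lucas_int_add_3[of t] by simp
  have F3: "fib_int (t + 3) = 2 * fib_int t + lucas_int t"
    using fib_int_add_3[of t] by simp
  have L2: "lucas_int (int n + 2) = 5 * fib_int (int n + 1) - lucas_int (int n)"
    using five_fib_int_eq_lucas_int[of "int n + 1"] by (simp add: add.commute)
  have F2: "fib_int (int n + 2) = lucas_int (int n + 1) - fib_int (int n)"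
    using lucas_int_eq_fib_int[of "int n + 1"] by (simp add: add.commute)
  show ?case
    \<comment> \<open>The shifted family is the original one at \<open>t + 3\<close>, hence the
      induction with \<open>t\<close> arbitrary.\<close>
    unfolding cheb_sum_rec shift
    unfolding ge2.IH[THEN conjunct1] ge2.IH[THEN conjunct2] idx L3 F3 L2 F2
    by (simp add: algebra_simps)
qed

text \<open>For \<open>n = 0\<close> the left side would vanish, as \<open>0 / 0 = 0\<close>, while
  the right side is \<open>g 0\<close>.\<close>

lemma sum_eq_half_cheb_sum:
  assumes "n > 0"
  shows "(\<Sum>k=0..n. (- 1) ^ (n - k) * (real n / real (n + k)) * real ((n + k) choose (n - k)) * g k)
         = cheb_sum n g / 2"
proof -
  have "(- 1) ^ (n - k) * (real n / real (n + k)) * real ((n + k) choose (n - k)) * g k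
      = (- 1) ^ (n + k) * cheb_coeff n k * g k / 2" if "k \<le> n" for k
  proof -
    have "(- 1 :: real) ^ (n - k) = (- 1) ^ (n + k)"
      using that by (simp add: minus_one_power_iff)
    then show ?thesis
      using cheb_coeff_closed_form[OF assms that] by (simp only: mult.assoc)
  qed
  then show ?thesis
    unfolding cheb_sum_def atMost_atLeast0 sum_divide_distrib by (intro sum.cong) auto
qed

theorem theorem10:
  fixes n :: nat and t :: int
  assumes "n > 0"
  shows "(\<Sum>k=0..n. (- 1) ^ (n - k) * (real n / real (n + k)) * real ((n + k) choose (n - k))
             * real_of_int (lucas_int (3 * int k + t)))
         = (if odd n then 5 / 2 * real_of_int (fib_int t) * real_of_int (fib_int (int n))
            else 1 / 2 * real_of_int (lucas_int t) * real_of_int (lucas_int (int n)))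
    \<and> (\<Sum>k=0..n. (- 1) ^ (n - k) * (real n / real (n + k)) * real ((n + k) choose (n - k))
             * real_of_int (fib_int (3 * int k + t)))
         = (if odd n then 1 / 2 * real_of_int (lucas_int t) * real_of_int (fib_int (int n))
            else 1 / 2 * real_of_int (fib_int t) * real_of_int (lucas_int (int n)))"
  unfolding sum_eq_half_cheb_sum[OF assms] using cheb_sum_lucas_fib[of n t] by simp

end
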